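(* Let $m\ge 1$ be an integer and $k\in[0,1]$, and let $R^k_{m,1}$ be the maximal positive root of the equation $\lambda_m(r)=0$, where $$\lambda_m (r)= 2r(1+k)(1+r^m)-(1-r)(1-r^m).$$ Suppose that $f(z)= h(z) + \overline{g(z)} =\sum_{n = 0}^\infty a_nz^n + \overline{\sum_{n = 1}^\infty b_nz^n}$ is a harmonic mapping of $\mathbb{D}$ such that $h\in\mathcal{B}$ and $|g'(z)|\leq k|h'(z)|$ for all $z\in\mathbb{D}$. Then $$|h(z^m)|+\sum_{n=1}^\infty |a_n|r^n + \sum_{n=1}^\infty |b_n|r^n \le 1\quad\text{for all } z\in\mathbb{D}\text{ with } |z|=r \le R^k_{m,1}.$$ Moreover, the constant $R^k_{m,1}$ cannot be improved, i.e. it cannot be replaced by any larger number: for every $R'\in(R^k_{m,1},1)$ there exist a harmonic mapping $f(z)=h(z)+\overline{g(z)}=\sum_{n=0}^\infty a_nz^n+\overline{\sum_{n=1}^\infty b_nz^n}$ of $\mathbb{D}$ with $h\in\mathcal{B}$ and $|g'(z)|\le k|h'(z)|$ for all $z\in\mathbb{D}$ (with the same $k$), and a point $z$ with $|z|=r\le R'$, for which $$|h(z^m)|+\sum_{n=1}^\infty |a_n|r^n + \sum_{n=1}^\infty |b_n|r^n > 1.$$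
   Context: $\mathbb{D}=\{z\in\mathbb{C}: |z|<1\}$, and $\mathcal{B}$ is the set of analytic functions $h$ in $\mathbb{D}$ with $|h(z)|<1$ for all $z\in\mathbb{D}$. A harmonic mapping of $\mathbb{D}$ is here a complex-valued function $f=h+\overline{g}$ with $h(z)=\sum_{n=0}^\infty a_nz^n$ and $g(z)=\sum_{n=1}^\infty b_nz^n$ analytic in $\mathbb{D}$ (so $g(0)=0$). *)

theory Defs
  imports "HOL-Complex_Analysis.Complex_Analysis"
begin

abbreviation unit_disc :: "complex set" where
  "unit_disc \<equiv> ball 0 1"

definition class_B :: "(complex \<Rightarrow> complex) set" where
  "class_B = {h. h holomorphic_on unit_disc \<and> (\<forall>z\<in>unit_disc. cmod (h z) < 1)}"

text \<open>The coefficient sequence of \<open>g\<close> starts at index \<open>1\<close>, so \<open>g 0 = 0\<close> and \<open>b 0\<close> plays no role.\<close>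

definition harmonic_mapping ::
  "(complex \<Rightarrow> complex) \<Rightarrow> (complex \<Rightarrow> complex) \<Rightarrow> (complex \<Rightarrow> complex) \<Rightarrow>
   (nat \<Rightarrow> complex) \<Rightarrow> (nat \<Rightarrow> complex) \<Rightarrow> bool" where
  "harmonic_mapping f h g a b \<longleftrightarrow>
     h holomorphic_on unit_disc \<and> g holomorphic_on unit_disc \<and>
     (\<forall>z\<in>unit_disc. f z = h z + cnj (g z)) \<and>
     (\<forall>z\<in>unit_disc. (\<lambda>n. a n * z ^ n) sums h z) \<and>
     (\<forall>z\<in>unit_disc. (\<lambda>n. b (Suc n) * z ^ Suc n) sums g z)"

definition lambda :: "real \<Rightarrow> nat \<Rightarrow> real \<Rightarrow> real" where
  "lambda k m r = 2 * r * (1 + k) * (1 + r ^ m) - (1 - r) * (1 - r ^ m)"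

definition max_root :: "real \<Rightarrow> nat \<Rightarrow> real" where
  "max_root k m = (GREATEST r. 0 < r \<and> lambda k m r = 0)"

definition bohr_sum ::
  "nat \<Rightarrow> (complex \<Rightarrow> complex) \<Rightarrow> (nat \<Rightarrow> complex) \<Rightarrow> (nat \<Rightarrow> complex) \<Rightarrow> complex \<Rightarrow> real \<Rightarrow> real" where
  "bohr_sum m h a b z r =
     cmod (h (z ^ m)) + (\<Sum>n. cmod (a (Suc n)) * r ^ Suc n) + (\<Sum>n. cmod (b (Suc n)) * r ^ Suc n)"

text \<open>The maximal positive root exists and lies in the open unit interval.\<close>

lemma lambda_pos:
  assumes "m \<ge> 1" "0 \<le> k" "1 \<le> r"
  shows "lambda k m r > 0"
proof -
  have rm: "1 \<le> r ^ m" using assms by simp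
  have "(1 - r) * (1 - r ^ m) = (r - 1) * (r ^ m - 1)" by (simp add: algebra_simps)
  also have "\<dots> \<le> r * r ^ m" using assms rm by (intro mult_mono) auto
  also have "\<dots> < r * (1 + r ^ m)" using assms by (simp add: algebra_simps)
  also have "\<dots> \<le> (2 * r * (1 + k)) * (1 + r ^ m)"
  proof (rule mult_right_mono)
    show "r \<le> 2 * r * (1 + k)" using assms by (simp add: algebra_simps)
  qed (use rm in simp)
  finally show ?thesis by (simp add: lambda_def)
qed

lemma lambda_strict_mono:
  assumes "m \<ge> 1" "0 \<le> k" "0 \<le> r" "r < s" "s \<le> 1"
  shows "lambda k m r < lambda k m s"
proof -
  have p: "r ^ m \<le> s ^ m" and q: "s ^ m \<le> 1" "0 \<le> r ^ m"
    using assms by (auto intro: power_mono power_le_one)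
  have "2 * r * (1 + k) * (1 + r ^ m) < 2 * s * (1 + k) * (1 + s ^ m)"
  proof (rule mult_less_le_imp_less)
    show "2 * r * (1 + k) < 2 * s * (1 + k)" using assms by (intro mult_strict_right_mono) auto
  qed (use assms p q in \<open>auto simp: add_pos_nonneg\<close>)
  moreover have "(1 - s) * (1 - s ^ m) \<le> (1 - r) * (1 - r ^ m)"
    using assms p q by (intro mult_mono) auto
  ultimately show ?thesis by (simp add: lambda_def)
qed

lemma max_root:
  assumes "m \<ge> 1" "0 \<le> k"
  shows "0 < max_root k m" "max_root k m < 1" "lambda k m (max_root k m) = 0"
    "\<And>r. 0 < r \<Longrightarrow> lambda k m r = 0 \<Longrightarrow> r \<le> max_root k m"
proof -
  have "lambda k m 0 \<le> 0" "0 \<le> lambda k m 1"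
    using assms by (auto simp: lambda_def power_0_left)
  moreover have "\<forall>x. 0 \<le> x \<and> x \<le> 1 \<longrightarrow> isCont (lambda k m) x"
    unfolding lambda_def by (intro allI impI continuous_intros)
  ultimately obtain r where r: "0 \<le> r" "r \<le> 1" "lambda k m r = 0"
    using IVT[of "lambda k m" 0 0 1] by auto
  have "r \<noteq> 0" using r assms by (auto simp: lambda_def power_0_left)
  moreover have less1: "s < 1" if "lambda k m s = 0" for s
    using lambda_pos[OF assms, of s] that by force
  moreover have le: "s \<le> r" if "0 < s" "lambda k m s = 0" for s
    using lambda_strict_mono[OF assms, of r s] r less1[OF that(2)] that by force
  moreover have "max_root k m = r"
    unfolding max_root_def using r \<open>r \<noteq> 0\<close> le by (intro Greatest_equality) auto
  ultimately show "0 < max_root k m" "max_root k m < 1" "lambda k m (max_root k m) = 0"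
    "\<And>r. 0 < r \<Longrightarrow> lambda k m r = 0 \<Longrightarrow> r \<le> max_root k m"
    using r by auto
qed

text \<open>The two real series in \<open>bohr_sum\<close> converge on the disc, so their \<open>suminf\<close> is the genuine sum.\<close>

lemma bohr_sum_summable:
  assumes "harmonic_mapping f h g a b" "0 \<le> r" "r < 1"
  shows "summable (\<lambda>n. cmod (a (Suc n)) * r ^ Suc n)"
    and "summable (\<lambda>n. cmod (b (Suc n)) * r ^ Suc n)"
proof -
  obtain s where s: "r < s" "s < 1" using dense[OF assms(3)] by auto
  have s_in: "complex_of_real s \<in> unit_disc" using s assms by simp
  have nr: "norm (complex_of_real r) < norm (complex_of_real s)" using s assms by simp
  have "summable (\<lambda>n. a n * complex_of_real s ^ n)"
    using assms(1) s_in unfolding harmonic_mapping_def by (meson sums_summable)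
  from powser_insidea[OF this nr]
  have "summable (\<lambda>n. cmod (a n) * r ^ n)"
    using assms by (simp add: norm_mult norm_power)
  then show "summable (\<lambda>n. cmod (a (Suc n)) * r ^ Suc n)"
    using summable_Suc_iff[of "\<lambda>n. cmod (a n) * r ^ n"] by blast
  have "summable (\<lambda>n. b (Suc n) * complex_of_real s ^ Suc n)"
    using assms(1) s_in unfolding harmonic_mapping_def by (meson sums_summable)
  then have "summable (\<lambda>n. b n * complex_of_real s ^ n)"
    using summable_Suc_iff[of "\<lambda>n. b n * complex_of_real s ^ n"] by blast
  from powser_insidea[OF this nr]
  have "summable (\<lambda>n. cmod (b n) * r ^ n)"
    using assms by (simp add: norm_mult norm_power)
  then show "summable (\<lambda>n. cmod (b (Suc n)) * r ^ Suc n)"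
    using summable_Suc_iff[of "\<lambda>n. cmod (b n) * r ^ n"] by blast
qed

end

theory Submission
  imports Defs
begin

text \<open>
  Write \<open>c = |a\<^sub>0|\<close>. Schwarz--Pick gives \<open>|h (z ^ m)| \<le> (c + r ^ m) / (1 + c * r ^ m)\<close>, and applied to
  averages of \<open>h\<close> over rotations it gives \<open>|a\<^sub>n| \<le> 1 - c\<^sup>2\<close>. Since \<open>|g'| \<le> k |h'|\<close>, one can write
  \<open>g' = \<omega> k h'\<close> with \<open>|\<omega>| \<le> 1\<close> holomorphic; Bohr's inequality for \<open>\<omega>\<close> then yields
  \<open>\<Sum> |b\<^sub>n| r ^ n \<le> k \<Sum> |a\<^sub>n| r ^ n\<close> for \<open>r \<le> 1/3\<close>, a range that contains the maximal root.
  What remains is an elementary inequality in \<open>c\<close> whose worst case is \<open>c \<rightarrow> 1\<close>, where it becomes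
  \<open>\<lambda>\<^sub>m(r) \<le> 0\<close>; disc automorphisms with \<open>c \<rightarrow> 1\<close> and \<open>g = k (h - h(0))\<close> show that this is sharp.
\<close>

section \<open>Schwarz-Pick estimates at the origin\<close>

text \<open>The disc automorphism taking \<open>h 0\<close> to 0, composed with \<open>h\<close>,
  satisfies the hypotheses of the Schwarz lemma. Its derivative bound gives the first claim; its
  growth bound gives the second, which is stated with the denominator cleared.\<close>

lemma Schwarz_Pick_origin:
  assumes hol: "h holomorphic_on unit_disc" and lt1: "\<And>z. z \<in> unit_disc \<Longrightarrow> cmod (h z) < 1"
  shows "cmod (deriv h 0) \<le> 1 - (cmod (h 0))\<^sup>2"
    and "cmod w < 1 \<Longrightarrow> cmod (h w) * (1 + cmod (h 0) * cmod w) \<le> cmod (h 0) + cmod w"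
proof -
  define c where "c = h 0"
  have c: "cmod c < 1" using lt1[of 0] by (simp add: c_def)
  define \<phi> where "\<phi> z = (h z - c) / (1 - cnj c * h z)" for z
  have prod_lt: "cmod (cnj c * h z) < 1" if "z \<in> unit_disc" for z
    using norm_mult_less[of "cnj c" 1 "h z" 1] c lt1[OF that] by simp
  have nz: "1 - cnj c * h z \<noteq> 0" if "z \<in> unit_disc" for z
    using prod_lt[OF that] by auto
  have hol\<phi>: "\<phi> holomorphic_on unit_disc"
    unfolding \<phi>_def by (intro holomorphic_intros hol nz)
  have \<phi>0: "\<phi> 0 = 0" by (simp add: \<phi>_def c_def)
  have \<phi>lt: "cmod (\<phi> z) < 1" if "cmod z < 1" for z
    using Moebius_function_norm_lt_1[OF c lt1, of z 0] that
    by (simp add: \<phi>_def Moebius_function_simple)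
  note Schwarz = Schwarz_Lemma[OF hol\<phi> \<phi>0 \<phi>lt]
  have cc: "1 - cnj c * c = of_real (1 - (cmod c)\<^sup>2)"
    by (simp only: of_real_diff of_real_1 complex_norm_square mult.commute)
  have c2: "1 - (cmod c)\<^sup>2 > 0"
    using c by (simp add: abs_square_less_1)
  have "(h has_field_derivative deriv h 0) (at 0)"
    by (rule holomorphic_derivI[OF hol]) auto
  then have "(\<phi> has_field_derivative
      (deriv h 0 * (1 - cnj c * h 0) - (h 0 - c) * (0 - cnj c * deriv h 0))
        / ((1 - cnj c * h 0) * (1 - cnj c * h 0))) (at 0)"
    unfolding \<phi>_def using nz[of 0] by (auto intro!: derivative_eq_intros)
  then have "deriv \<phi> 0 = deriv h 0 / (1 - cnj c * c)"
    using nz[of 0] by (simp add: DERIV_imp_deriv c_def)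
  then have "cmod (deriv h 0) / (1 - (cmod c)\<^sup>2) \<le> 1"
    using Schwarz(2)[of 0] c2 unfolding cc by (simp add: norm_divide del: of_real_diff)
  then show "cmod (deriv h 0) \<le> 1 - (cmod (h 0))\<^sup>2"
    using c2 by (simp add: c_def)
  show "cmod (h w) * (1 + cmod (h 0) * cmod w) \<le> cmod (h 0) + cmod w" if w: "cmod w < 1"
  proof -
    define x y p where "x = cmod (h w)" and "y = cmod c" and "p = cmod (1 - cnj c * h w)"
    have x: "0 \<le> x" "x < 1" and y: "0 \<le> y" "y < 1"
      using lt1[of w] w c by (auto simp: x_def y_def)
    have xy: "x * y < 1" using prod_lt[of w] w by (simp add: x_def y_def norm_mult mult.commute)
    have "cmod (\<phi> w) \<le> cmod w" using Schwarz(1)[OF _ w] by simp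
    then have "cmod (h w - c) \<le> cmod w * p"
      using nz[of w] w by (simp add: \<phi>_def p_def norm_divide field_simps)
    then have "(cmod (h w - c))\<^sup>2 \<le> (cmod w)\<^sup>2 * p\<^sup>2"
      by (metis norm_ge_zero power_mono power_mult_distrib)
    \<comment> \<open>This identity passes from the points \<open>h w\<close> and \<open>c\<close>
      to their moduli: the Schwarz bound becomes an upper bound for \<open>p\<close>, while the
      triangle inequality gives \<open>1 - x * y \<le> p\<close>. The same identity for the real
      numbers \<open>x\<close> and \<open>y\<close> then yields
      \<open>\<bar>x - y\<bar> \<le> cmod w * (1 - x * y)\<close>.\<close>
    moreover have "p\<^sup>2 - (cmod (h w - c))\<^sup>2 = (1 - x\<^sup>2) * (1 - y\<^sup>2)"
      unfolding p_def x_def y_def cmod_power2 by (simp add: algebra_simps power2_eq_square)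
    ultimately have "(1 - (cmod w)\<^sup>2) * p\<^sup>2 \<le> (1 - x\<^sup>2) * (1 - y\<^sup>2)"
      by (simp add: algebra_simps)
    moreover have "1 - x * y \<le> p"
      using norm_triangle_ineq2[of 1 "cnj c * h w"]
      by (simp add: p_def x_def y_def norm_mult mult.commute)
    then have "(1 - (cmod w)\<^sup>2) * (1 - x * y)\<^sup>2 \<le> (1 - (cmod w)\<^sup>2) * p\<^sup>2"
      using xy w by (intro mult_left_mono power_mono) (auto simp: power_le_one)
    ultimately have "(1 - (cmod w)\<^sup>2) * (1 - x * y)\<^sup>2 \<le> (1 - x\<^sup>2) * (1 - y\<^sup>2)"
      by linarith
    moreover have "(1 - x\<^sup>2) * (1 - y\<^sup>2) = (1 - x * y)\<^sup>2 - (x - y)\<^sup>2"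
      by (simp add: algebra_simps power2_eq_square)
    ultimately have "(x - y)\<^sup>2 \<le> (cmod w * (1 - x * y))\<^sup>2"
      by (simp add: left_diff_distrib power_mult_distrib)
    then have "x - y \<le> cmod w * (1 - x * y)"
      by (rule power2_le_imp_le) (use xy in simp)
    then show ?thesis
      by (simp add: x_def y_def c_def algebra_simps)
  qed
qed

section \<open>Coefficients of bounded power series and Bohr's inequality\<close>

text \<open>Orthogonality of the powers of a primitive root of unity: unless
  \<open>\<zeta> ^ k = 1\<close>, the sum is a geometric one with numerator
  \<open>1 - (\<zeta> ^ k) ^ n = 0\<close>. It serves as a filter for the coefficients whose index
  is a multiple of \<open>n\<close>.\<close>

lemma sum_powers_root_unity:
  fixes n k :: nat
  assumes "n > 0"
  defines "\<zeta> \<equiv> exp (2 * of_real pi * \<i> / of_nat n)"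
  shows "(\<Sum>j<n. (\<zeta> ^ j) ^ k) = (if n dvd k then of_nat n else 0)"
proof -
  have \<zeta>n: "\<zeta> ^ n = 1"
    using assms by (simp add: exp_of_nat_mult [symmetric])
  have \<zeta>k: "\<zeta> ^ k = exp (2 * of_real pi * \<i> * of_nat k / of_nat n)"
    by (simp add: \<zeta>_def exp_of_nat_mult [symmetric] algebra_simps)
  have eq: "(\<Sum>j<n. (\<zeta> ^ j) ^ k) = (\<Sum>j<n. (\<zeta> ^ k) ^ j)"
    by (simp add: power_mult [symmetric] mult.commute)
  show ?thesis
  proof (cases "n dvd k")
    case True
    then have "\<zeta> ^ k = 1" using \<zeta>n by (auto simp: power_mult)
    with True eq show ?thesis by simp
  next
    case False
    then have "\<zeta> ^ k \<noteq> 1"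
      using complex_root_unity_eq_1[of n k] assms(1) \<zeta>k by auto
    moreover have "(\<zeta> ^ k) ^ n = 1"
      by (metis \<zeta>n power_mult power_one mult.commute)
    ultimately show ?thesis
      using False eq by (simp add: sum_gp_strict)
  qed
qed

text \<open>Bridge to formal power series, used to read off a derivative at 0 as a coefficient and,
  later, to compare coefficients in \<open>g' = \<omega> k h'\<close>.\<close>

lemma powser_has_fps_expansion:
  fixes a :: "nat \<Rightarrow> complex"
  assumes "\<And>z. z \<in> unit_disc \<Longrightarrow> (\<lambda>n. a n * z ^ n) sums h z"
  shows "h has_fps_expansion Abs_fps a"
proof (rule has_fps_expansionI)
  have "\<forall>\<^sub>F z in nhds 0. z \<in> (unit_disc :: complex set)"
    by (intro eventually_nhds_in_open) auto
  then show "\<forall>\<^sub>F z in nhds 0. (\<lambda>n. fps_nth (Abs_fps a) n * z ^ n) sums h z"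
    by eventually_elim (use assms in simp)
qed

lemma powser_coeff_le_strict:
  fixes a :: "nat \<Rightarrow> complex"
  assumes sums: "\<And>z. z \<in> unit_disc \<Longrightarrow> (\<lambda>n. a n * z ^ n) sums h z"
    and lt1: "\<And>z. z \<in> unit_disc \<Longrightarrow> cmod (h z) < 1"
    and "n > 0"
  shows "cmod (a n) \<le> 1 - (cmod (a 0))\<^sup>2"
proof -
  \<comment> \<open>Averaging \<open>h\<close> over the rotations by \<open>n\<close>-th roots of unity leaves \<open>G (z ^ n)\<close> with
      \<open>G w = (\<Sum>j. a (n * j) * w ^ j)\<close>, which is again bounded by 1.\<close>
  define \<zeta> where "\<zeta> = exp (2 * of_real pi * \<i> / of_nat n)"
  have \<zeta>: "cmod \<zeta> = 1" by (simp add: \<zeta>_def)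
  have ex: "\<exists>G. (\<lambda>j. a (n * j) * w ^ j) sums G \<and> cmod G < 1" if w: "w \<in> unit_disc" for w
  proof -
    obtain z where z: "z ^ n = w"
      using exists_complex_root[of n w] \<open>n > 0\<close> by auto
    have "cmod z ^ n < 1" using w z by (auto simp: norm_power [symmetric])
    then have z1: "cmod z < 1"
      by (metis one_le_power linorder_not_less)
    have in_disc: "\<zeta> ^ j * z \<in> unit_disc" for j
      using z1 \<zeta> by (simp add: norm_mult norm_power)
    define G where "G = (\<Sum>j<n. h (\<zeta> ^ j * z)) / of_nat n"
    have "(\<lambda>k. \<Sum>j<n. a k * (\<zeta> ^ j * z) ^ k) sums (\<Sum>j<n. h (\<zeta> ^ j * z))"
      by (intro sums_sum sums in_disc)
    then have "(\<lambda>k. (\<Sum>j<n. a k * (\<zeta> ^ j * z) ^ k) / of_nat n) sums G"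
      unfolding G_def by (rule sums_divide)
    moreover have "(\<Sum>j<n. a k * (\<zeta> ^ j * z) ^ k) / of_nat n = (if n dvd k then a k * z ^ k else 0)" for k
    proof -
      have "(\<Sum>j<n. a k * (\<zeta> ^ j * z) ^ k) = a k * z ^ k * (\<Sum>j<n. (\<zeta> ^ j) ^ k)"
        by (simp add: power_mult_distrib sum_distrib_left algebra_simps)
      then show ?thesis
        using sum_powers_root_unity[OF \<open>n > 0\<close>, of k] \<open>n > 0\<close> by (simp add: \<zeta>_def)
    qed
    ultimately have "(\<lambda>k. if n dvd k then a k * z ^ k else 0) sums G" by simp
    \<comment> \<open>Only multiples of \<open>n\<close> contribute, so the series may be reindexed
      along \<open>j \<mapsto> n * j\<close>.\<close>
    then have "(\<lambda>j. if n dvd (n * j) then a (n * j) * z ^ (n * j) else 0) sums G"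
      by (subst sums_mono_reindex[where g = "\<lambda>j. n * j"])
        (use \<open>n > 0\<close> in \<open>auto simp: strict_mono_def\<close>)
    then have "(\<lambda>j. a (n * j) * w ^ j) sums G"
      by (simp add: z [symmetric] power_mult)
    moreover have "cmod G < 1"
    proof -
      have "cmod (\<Sum>j<n. h (\<zeta> ^ j * z)) \<le> (\<Sum>j<n. cmod (h (\<zeta> ^ j * z)))"
        by (rule norm_sum)
      also have "\<dots> < (\<Sum>j<n. 1)"
        using \<open>n > 0\<close> by (intro sum_strict_mono lt1 in_disc) auto
      finally show ?thesis
        using \<open>n > 0\<close> by (simp add: G_def norm_divide)
    qed
    ultimately show ?thesis by blast
  qed
  \<comment> \<open>The average in \<open>ex\<close> was built from a chosen \<open>n\<close>-th
    root of \<open>w\<close>. Its power series in \<open>w\<close> does not depend on that choice,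
    so it defines a function to which Schwarz-Pick applies, with value \<open>a 0\<close> and
    derivative \<open>a n\<close> at the origin.\<close>
  define G where "G w = (\<Sum>j. a (n * j) * w ^ j)" for w
  have G: "(\<lambda>j. a (n * j) * w ^ j) sums G w" "cmod (G w) < 1" if "w \<in> unit_disc" for w
    using ex[OF that] by (auto simp: G_def sums_iff)
  have "G holomorphic_on unit_disc"
    by (rule power_series_holomorphic[where a = "\<lambda>j. a (n * j)"]) (use G in auto)
  moreover have "G 0 = a 0"
    by (simp add: G_def)
  moreover have "deriv G 0 = a n"
    using fps_nth_fps_expansion[OF powser_has_fps_expansion[of "\<lambda>j. a (n * j)" G], of 1] G
    by simp
  ultimately show ?thesis
    using Schwarz_Pick_origin(1)[of G] G(2) by auto
qed

text \<open>The weak bound is needed for the quotient \<omega>, which may be a unimodular constant.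
  It follows from the strict case applied to \<open>t * h\<close> with \<open>t < 1\<close>, as
  \<open>t\<close> tends to 1.\<close>

lemma powser_coeff_le:
  fixes a :: "nat \<Rightarrow> complex"
  assumes sums: "\<And>z. z \<in> unit_disc \<Longrightarrow> (\<lambda>n. a n * z ^ n) sums h z"
    and le1: "\<And>z. z \<in> unit_disc \<Longrightarrow> cmod (h z) \<le> 1"
    and "n > 0"
  shows "cmod (a n) \<le> 1 - (cmod (a 0))\<^sup>2"
proof (rule tendsto_le[of "at_left (1::real)"])
  show "((\<lambda>t. t * cmod (a n)) \<longlongrightarrow> cmod (a n)) (at_left 1)"
    by (auto intro!: tendsto_eq_intros)
  show "((\<lambda>t. 1 - (t * cmod (a 0))\<^sup>2) \<longlongrightarrow> 1 - (cmod (a 0))\<^sup>2) (at_left 1)"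
    by (auto intro!: tendsto_eq_intros)
  have "\<forall>\<^sub>F t in at_left (1::real). t \<in> {0<..<1}"
    by (rule eventually_at_left_real) simp
  then show "\<forall>\<^sub>F t in at_left 1. t * cmod (a n) \<le> 1 - (t * cmod (a 0))\<^sup>2"
  proof eventually_elim
    case (elim t)
    have "(\<lambda>n. (of_real t * a n) * z ^ n) sums (of_real t * h z)" if "z \<in> unit_disc" for z
      using sums_mult[OF sums[OF that], of "of_real t"] by (simp add: mult.assoc)
    moreover have "cmod (of_real t * h z) < 1" if "z \<in> unit_disc" for z
    proof -
      have "t * cmod (h z) \<le> t * 1"
        using elim le1[OF that] by (intro mult_left_mono) auto
      also have "t * 1 < 1" using elim by simp
      finally have "t * cmod (h z) < 1" .
      then show ?thesis using elim by (simp add: norm_mult)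
    qed
    ultimately show ?case
      using powser_coeff_le_strict[of "\<lambda>n. of_real t * a n" "\<lambda>z. of_real t * h z" n] elim \<open>n > 0\<close>
      by (simp add: norm_mult)
  qed
qed simp

lemma powser_majorant_le:
  fixes a :: "nat \<Rightarrow> complex"
  assumes sums: "\<And>z. z \<in> unit_disc \<Longrightarrow> (\<lambda>n. a n * z ^ n) sums h z"
    and le1: "\<And>z. z \<in> unit_disc \<Longrightarrow> cmod (h z) \<le> 1"
    and r: "0 \<le> r" "r < 1"
  shows "summable (\<lambda>n. cmod (a (Suc n)) * r ^ Suc n)"
    and "(\<Sum>n. cmod (a (Suc n)) * r ^ Suc n) \<le> (1 - (cmod (a 0))\<^sup>2) * (r / (1 - r))"
proof -
  have s: "(\<lambda>n. (1 - (cmod (a 0))\<^sup>2) * r ^ Suc n) sums ((1 - (cmod (a 0))\<^sup>2) * (r / (1 - r)))"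
    using geometric_sums[of r] r
    by (intro sums_mult) (auto dest: sums_mult[of _ _ r])
  have le: "cmod (a (Suc n)) * r ^ Suc n \<le> (1 - (cmod (a 0))\<^sup>2) * r ^ Suc n" for n
    using powser_coeff_le[OF sums le1, of "Suc n"] r by (intro mult_right_mono) auto
  show sm: "summable (\<lambda>n. cmod (a (Suc n)) * r ^ Suc n)"
    by (rule summable_comparison_test[OF _ sums_summable[OF s]]) (use le r in auto)
  show "(\<Sum>n. cmod (a (Suc n)) * r ^ Suc n) \<le> (1 - (cmod (a 0))\<^sup>2) * (r / (1 - r))"
    using suminf_le[OF le sm sums_summable[OF s]] sums_unique[OF s] by simp
qed

text \<open>For \<open>r \<le> 1/3\<close> the geometric factor \<open>r / (1 - r)\<close> is at
  most 1/2, and \<open>x + (1 - x\<^sup>2) / 2 \<le> 1\<close> is just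
  \<open>(1 - x)\<^sup>2 \<ge> 0\<close> for \<open>x = cmod (a 0)\<close>.\<close>

lemma Bohr_inequality:
  fixes a :: "nat \<Rightarrow> complex"
  assumes sums: "\<And>z. z \<in> unit_disc \<Longrightarrow> (\<lambda>n. a n * z ^ n) sums h z"
    and le1: "\<And>z. z \<in> unit_disc \<Longrightarrow> cmod (h z) \<le> 1"
    and r: "0 \<le> r" "r \<le> 1/3"
  shows "summable (\<lambda>n. cmod (a n) * r ^ n)" and "(\<Sum>n. cmod (a n) * r ^ n) \<le> 1"
proof -
  have a0: "cmod (a 0) \<le> 1"
  proof -
    have "(\<lambda>n. a n * 0 ^ n) sums h 0" by (rule sums) simp
    then have "h 0 = a 0" by (simp add: sums_iff)
    then show ?thesis using le1[of 0] by simp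
  qed
  have sm: "summable (\<lambda>n. cmod (a (Suc n)) * r ^ Suc n)"
    by (rule powser_majorant_le(1)[OF sums le1]) (use r in auto)
  then show sm0: "summable (\<lambda>n. cmod (a n) * r ^ n)"
    using summable_Suc_iff[of "\<lambda>n. cmod (a n) * r ^ n"] by blast
  have "(\<Sum>n. cmod (a n) * r ^ n) = cmod (a 0) + (\<Sum>n. cmod (a (Suc n)) * r ^ Suc n)"
    using suminf_split_head[OF sm0] by simp
  also have "(\<Sum>n. cmod (a (Suc n)) * r ^ Suc n) \<le> (1 - (cmod (a 0))\<^sup>2) * (r / (1 - r))"
    by (rule powser_majorant_le(2)[OF sums le1]) (use r in auto)
  also have "\<dots> \<le> (1 - (cmod (a 0))\<^sup>2) * (1/2)"
    using r a0 by (intro mult_left_mono) (auto simp: field_simps abs_square_le_1)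
  also have "cmod (a 0) + (1 - (cmod (a 0))\<^sup>2) * (1/2) \<le> 1"
    using zero_le_power2[of "1 - cmod (a 0)"] by (simp add: power2_eq_square algebra_simps)
  finally show "(\<Sum>n. cmod (a n) * r ^ n) \<le> 1" by simp
qed

section \<open>Comparing the majorant series of g and h\<close>

text \<open>Unless \<open>G\<close> vanishes identically, in which case \<open>F\<close> does too,
  its zeros are isolated. Near them \<open>F / G\<close> stays bounded by 1, so the singularities
  are removable.\<close>

lemma holomorphic_quotient_bounded:
  assumes F: "F holomorphic_on S" and G: "G holomorphic_on S" and S: "open S" "connected S"
    and le: "\<And>z. z \<in> S \<Longrightarrow> cmod (F z) \<le> cmod (G z)"
  obtains \<omega> where "\<omega> holomorphic_on S" "\<And>z. z \<in> S \<Longrightarrow> cmod (\<omega> z) \<le> 1"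
    "\<And>z. z \<in> S \<Longrightarrow> F z = \<omega> z * G z"
proof (cases "\<forall>z\<in>S. G z = 0")
  case True
  then show ?thesis
    using le by (intro that[of "\<lambda>_. 0"]) auto
next
  case False
  then obtain \<beta> where \<beta>: "\<beta> \<in> S" "G \<beta> \<noteq> 0" by blast
  define q where "q z = F z / G z" for z
  \<comment> \<open>At a zero of \<open>G\<close> the quotient takes the default value 0, so the
    bound holds there as well; but \<open>q\<close> need not be continuous at such a point, whence
    \<open>remove_sings\<close> below.\<close>
  have q_le: "cmod (q z) \<le> 1" if "z \<in> S" for z
    using le[OF that] by (cases "G z = 0") (auto simp: q_def norm_divide)
  have q: "isolated_singularity_at q z \<and> (\<exists>c. q \<midarrow>z\<rightarrow> c \<and> cmod c \<le> 1)" if z: "z \<in> S" for z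
  proof -
    obtain r where r: "r > 0" "ball z r \<subseteq> S" "\<And>w. w \<in> ball z r - {z} \<Longrightarrow> G w \<noteq> 0"
    proof (cases "G z = 0")
      case True
      from isolated_zeros[OF G S z True \<beta>] that show ?thesis by blast
    next
      case False
      have "open (S \<inter> G -` (-{0}))"
        using G S by (intro continuous_open_preimage holomorphic_on_imp_continuous_on) auto
      then obtain r where "r > 0" "ball z r \<subseteq> S \<inter> G -` (-{0})"
        using z False openE[of _ z] by blast
      then show ?thesis by (intro that[of r]) auto
    qed
    have hol: "q holomorphic_on ball z r - {z}"
      unfolding q_def using r by (intro holomorphic_intros holomorphic_on_subset[OF F] holomorphic_on_subset[OF G]) auto
    have iso: "isolated_singularity_at q z"
      using hol r(1) by (auto simp: isolated_singularity_at_def analytic_on_open open_Diff intro!: exI[of _ r])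
    have ev: "\<forall>\<^sub>F w in at z. cmod (q w) \<le> 1"
      using eventually_at_in_open[OF S(1) z] by eventually_elim (use q_le in auto)
    \<comment> \<open>The local extension shows that \<open>q\<close> has a limit at
      \<open>z\<close>. The limit inherits the bound 1 and is the value that
      \<open>remove_sings q\<close> takes there.\<close>
    then obtain q' where q': "q' holomorphic_on ball z r" "\<And>w. w \<in> ball z r - {z} \<Longrightarrow> q' w = q w"
      using holomorphic_on_extend_bounded[OF hol] r(1) by (auto simp: interior_open)
    have "isCont q' z"
      using q'(1) r(1) by (meson centre_in_ball continuous_on_eq_continuous_at holomorphic_on_imp_continuous_on open_ball)
    then have "q' \<midarrow>z\<rightarrow> q' z" by (rule isContD)
    moreover have "\<forall>\<^sub>F w in at z. q' w = q w"
      by (rule eventually_mono[OF eventually_at_in_open[of "ball z r"]]) (use q' r(1) in auto)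
    ultimately have lim: "q \<midarrow>z\<rightarrow> q' z"
      by (rule Lim_transform_eventually)
    moreover have "cmod (q' z) \<le> 1"
      by (rule tendsto_upperbound[OF tendsto_norm[OF lim] ev]) simp
    ultimately show ?thesis using iso by blast
  qed
  define \<omega> where "\<omega> = remove_sings q"
  have "\<omega> analytic_on {z}" if "z \<in> S" for z
    unfolding \<omega>_def using q[OF that] remove_sings_analytic_at by blast
  then have "\<omega> holomorphic_on S"
    by (meson analytic_imp_holomorphic analytic_on_analytic_at)
  moreover have "cmod (\<omega> z) \<le> 1" if "z \<in> S" for z
    unfolding \<omega>_def using q[OF that] remove_sings_eqI by metis
  moreover have "F z = \<omega> z * G z" if z: "z \<in> S" for z
  proof (cases "G z = 0")
    case True
    then show ?thesis using le[OF z] by simp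
  next
    case False
    have "isCont F z" "isCont G z"
      using F G z S(1) by (meson continuous_on_eq_continuous_at holomorphic_on_imp_continuous_on)+
    then have "q \<midarrow>z\<rightarrow> q z"
      unfolding q_def using False by (intro tendsto_intros isContD) auto
    then have "\<omega> z = q z" unfolding \<omega>_def by (rule remove_sings_eqI)
    then show ?thesis using False by (simp add: q_def)
  qed
  ultimately show ?thesis by (rule that)
qed

lemma powser_majorant_le_of_deriv_le:
  fixes a b :: "nat \<Rightarrow> complex"
  assumes h: "h holomorphic_on unit_disc" "\<And>z. z \<in> unit_disc \<Longrightarrow> (\<lambda>n. a n * z ^ n) sums h z"
    and g: "g holomorphic_on unit_disc" "\<And>z. z \<in> unit_disc \<Longrightarrow> (\<lambda>n. b n * z ^ n) sums g z"
    and k: "0 \<le> k" and le: "\<And>z. z \<in> unit_disc \<Longrightarrow> cmod (deriv g z) \<le> k * cmod (deriv h z)"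
    and r: "0 \<le> r" "r \<le> 1/3"
    and sa: "summable (\<lambda>n. cmod (a (Suc n)) * r ^ Suc n)"
    and sb: "summable (\<lambda>n. cmod (b (Suc n)) * r ^ Suc n)"
  shows "(\<Sum>n. cmod (b (Suc n)) * r ^ Suc n) \<le> k * (\<Sum>n. cmod (a (Suc n)) * r ^ Suc n)"
proof -
  obtain \<omega> where \<omega>: "\<omega> holomorphic_on unit_disc" "\<And>z. z \<in> unit_disc \<Longrightarrow> cmod (\<omega> z) \<le> 1"
    and eq: "\<And>z. z \<in> unit_disc \<Longrightarrow> deriv g z = \<omega> z * (of_real k * deriv h z)"
    by (rule holomorphic_quotient_bounded[of "deriv g" unit_disc "\<lambda>z. of_real k * deriv h z"])
      (use h(1) g(1) le k in \<open>auto intro!: holomorphic_intros simp: norm_mult\<close>)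
  define w where "w n = (deriv ^^ n) \<omega> 0 / fact n" for n
  have w: "(\<lambda>n. w n * z ^ n) sums \<omega> z" if "z \<in> unit_disc" for z
    using holomorphic_power_series[OF \<omega>(1) that] by (simp add: w_def)
  have "(\<lambda>z. \<omega> z * (of_real k * deriv h z)) has_fps_expansion
      Abs_fps w * (fps_const (of_real k) * fps_deriv (Abs_fps a))"
    by (intro fps_expansion_intros powser_has_fps_expansion h w)
  moreover have "deriv g has_fps_expansion fps_deriv (Abs_fps b)"
    by (intro fps_expansion_intros powser_has_fps_expansion g)
  moreover have "\<forall>\<^sub>F z in nhds 0. deriv g z = \<omega> z * (of_real k * deriv h z)"
    using eventually_nhds_in_open[of unit_disc "0::complex"] by (auto elim!: eventually_mono intro: eq)
  ultimately have fps: "fps_deriv (Abs_fps b) = Abs_fps w * (fps_const (of_real k) * fps_deriv (Abs_fps a))"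
    using fps_expansion_unique_complex has_fps_expansion_cong by metis
  \<comment> \<open>Comparing coefficients gives \<open>n * b n = k * (\<Sum>j<n. w j * (n - j) * a (n - j))\<close>;
      the factors \<open>(n - j) / n \<le> 1\<close> can be dropped.\<close>
  have b_le: "cmod (b (Suc n)) \<le> k * (\<Sum>j\<le>n. cmod (w j) * cmod (a (Suc (n - j))))" for n
  proof -
    have "of_nat (Suc n) * b (Suc n) = (\<Sum>j\<le>n. w j * (of_real k * (of_nat (Suc (n - j)) * a (Suc (n - j)))))"
      using arg_cong[OF fps, of "\<lambda>F. fps_nth F n"]
      by (simp add: fps_mult_nth[of "Abs_fps w"] atLeast0AtMost del: of_nat_Suc)
    then have "real (Suc n) * cmod (b (Suc n))
        = cmod (\<Sum>j\<le>n. w j * (of_real k * (of_nat (Suc (n - j)) * a (Suc (n - j)))))"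
      by (metis norm_mult norm_of_nat)
    also have "\<dots> \<le> (\<Sum>j\<le>n. cmod (w j) * (k * (real (Suc (n - j)) * cmod (a (Suc (n - j))))))"
      by (rule order_trans[OF norm_sum]) (use k in \<open>simp add: norm_mult del: of_nat_Suc\<close>)
    also have "\<dots> \<le> (\<Sum>j\<le>n. cmod (w j) * (k * (real (Suc n) * cmod (a (Suc (n - j))))))"
      using k by (intro sum_mono mult_left_mono mult_right_mono) auto
    also have "\<dots> = real (Suc n) * (k * (\<Sum>j\<le>n. cmod (w j) * cmod (a (Suc (n - j)))))"
      by (simp add: sum_distrib_left algebra_simps)
    finally show ?thesis
      by (simp del: of_nat_Suc)
  qed
  note bohr = Bohr_inequality[OF w \<omega>(2) r]
  let ?W = "\<lambda>n. cmod (w n) * r ^ n" and ?A = "\<lambda>n. cmod (a (Suc n)) * r ^ Suc n"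
  have norms: "summable (\<lambda>n. norm (?W n))" "summable (\<lambda>n. norm (?A n))"
    using bohr(1) sa r by simp_all
  \<comment> \<open>Splitting \<open>r ^ Suc n\<close> as \<open>r ^ j * r ^ Suc (n - j)\<close>
    turns the coefficient bound into a term of the Cauchy product of the majorants of \<omega> and
    of \<open>h\<close> without its constant term. Bohr's inequality then bounds the first factor by
    1.\<close>
  have conv: "cmod (b (Suc n)) * r ^ Suc n \<le> k * (\<Sum>j\<le>n. ?W j * ?A (n - j))" for n
  proof -
    have "cmod (b (Suc n)) * r ^ Suc n
        \<le> (k * (\<Sum>j\<le>n. cmod (w j) * cmod (a (Suc (n - j))))) * r ^ Suc n"
      using r by (intro mult_right_mono b_le) auto
    also have "\<dots> = k * (\<Sum>j\<le>n. (cmod (w j) * cmod (a (Suc (n - j)))) * r ^ Suc n)"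
      by (simp add: sum_distrib_right mult.assoc)
    also have "(\<Sum>j\<le>n. (cmod (w j) * cmod (a (Suc (n - j)))) * r ^ Suc n) = (\<Sum>j\<le>n. ?W j * ?A (n - j))"
    proof (rule sum.cong[OF refl])
      fix j assume "j \<in> {..n}"
      then have "r ^ Suc n = r ^ j * r ^ Suc (n - j)"
        by (simp add: power_add [symmetric])
      then show "cmod (w j) * cmod (a (Suc (n - j))) * r ^ Suc n = ?W j * ?A (n - j)"
        by (simp only: mult_ac)
    qed
    finally show ?thesis .
  qed
  have "(\<Sum>n. cmod (b (Suc n)) * r ^ Suc n) \<le> (\<Sum>n. k * (\<Sum>j\<le>n. ?W j * ?A (n - j)))"
    by (intro suminf_le conv sb summable_mult summable_Cauchy_product norms)
  also have "\<dots> = k * ((\<Sum>n. ?W n) * (\<Sum>n. ?A n))"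
    using Cauchy_product[OF norms] summable_Cauchy_product[OF norms] by (simp add: suminf_mult)
  also have "\<dots> \<le> k * (1 * (\<Sum>n. ?A n))"
    using bohr(2) k sa r by (intro mult_left_mono mult_right_mono suminf_nonneg) auto
  finally show ?thesis by simp
qed

section \<open>The inequality up to the maximal root\<close>

text \<open>\<open>lambda\<close> is increasing on the unit interval and already positive at 1/3,
  even for \<open>k = 0\<close>, so its root lies to the left. This brings the whole range of radii
  within reach of Bohr's inequality.\<close>

lemma max_root_less_third:
  assumes "m \<ge> 1" "0 \<le> k"
  shows "max_root k m < 1/3"
proof (rule ccontr)
  assume "\<not> max_root k m < 1/3"
  then have "lambda k m (1/3) \<le> lambda k m (max_root k m)"
    using lambda_strict_mono[OF assms, of "1/3" "max_root k m"] max_root(2)[OF assms]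
    by (metis less_eq_real_def linorder_not_less zero_le_divide_1_iff zero_le_numeral)
  moreover have "lambda k m (1/3) = 2/3 * (k * (1 + (1/3) ^ m) + 2 * (1/3) ^ m)"
    by (simp add: lambda_def algebra_simps add_divide_distrib)
  moreover have "\<dots> > 0"
    using assms by (intro mult_pos_pos add_nonneg_pos mult_nonneg_nonneg) auto
  ultimately show False using max_root(3)[OF assms] by simp
qed

lemma bohr_sum_le_one:
  assumes mk: "m \<ge> 1" "0 \<le> k"
    and f: "harmonic_mapping f h g a b" and B: "h \<in> class_B"
    and le: "\<And>z. z \<in> unit_disc \<Longrightarrow> cmod (deriv g z) \<le> k * cmod (deriv h z)"
    and z: "cmod z \<le> max_root k m"
  shows "bohr_sum m h a b z (cmod z) \<le> 1"
proof -
  define r where "r = cmod z"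
  define c where "c = cmod (a 0)"
  define p where "p = r ^ m"
  have r: "0 \<le> r" "r \<le> 1/3" "r < 1"
    using z max_root_less_third[OF mk] by (auto simp: r_def)
  have p: "0 \<le> p" "p < 1"
    using r mk by (auto simp: p_def power_less_one_iff)
  have h: "h holomorphic_on unit_disc" "\<And>z. z \<in> unit_disc \<Longrightarrow> (\<lambda>n. a n * z ^ n) sums h z"
    "\<And>z. z \<in> unit_disc \<Longrightarrow> cmod (h z) < 1" and g: "g holomorphic_on unit_disc"
    using f B by (auto simp: harmonic_mapping_def class_B_def)
  have h0: "h 0 = a 0"
    using h(2)[of 0] by (simp add: sums_iff)
  have c: "0 \<le> c" "c < 1"
    using h(3)[of 0] by (simp_all add: c_def h0)
  \<comment> \<open>\<open>harmonic_mapping\<close> expands \<open>g\<close> from index 1 on; a zero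
    constant coefficient completes this to a full power series.\<close>
  define b' where "b' = b(0 := 0)"
  have g': "(\<lambda>n. b' n * z ^ n) sums g z" if "z \<in> unit_disc" for z
    using f that sums_Suc_iff[of "\<lambda>n. b' n * z ^ n" "g z"]
    by (simp add: harmonic_mapping_def b'_def)
  note summable = bohr_sum_summable[OF f r(1,3)]
  have "(\<Sum>n. cmod (b (Suc n)) * r ^ Suc n) \<le> k * (\<Sum>n. cmod (a (Suc n)) * r ^ Suc n)"
    using powser_majorant_le_of_deriv_le[OF h(1,2) g g' mk(2) le r(1,2)] summable
    by (simp add: b'_def)
  moreover have "(1 + k) * (\<Sum>n. cmod (a (Suc n)) * r ^ Suc n) \<le> (1 + k) * ((1 - c\<^sup>2) * (r / (1 - r)))"
    unfolding c_def using mk h r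
    by (intro mult_left_mono powser_majorant_le(2)) (auto intro: less_imp_le)
  moreover have "cmod (h (z ^ m)) \<le> (c + p) / (1 + c * p)"
  proof -
    have "cmod (h (z ^ m)) * (1 + c * p) \<le> c + p"
      using Schwarz_Pick_origin(2)[OF h(1,3), of "z ^ m"] p
      by (simp add: norm_power h0 c_def p_def r_def)
    then show ?thesis
      using c p by (simp add: pos_le_divide_eq add_pos_nonneg)
  qed
  \<comment> \<open>Since
    \<open>1 - (c + p) / (1 + c * p) = (1 - c) * (1 - p) / (1 + c * p)\<close>, a factor
    \<open>1 - c\<close> splits off both sides. What is left is
    \<open>(1 + k) * r * (1 + c) * (1 + c * p) \<le> (1 - r) * (1 - p)\<close>; its left side
    increases with \<open>c\<close>, and at \<open>c = 1\<close> it reads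
    \<open>lambda k m r \<le> 0\<close>.\<close>
  moreover have "(c + p) / (1 + c * p) + (1 + k) * ((1 - c\<^sup>2) * (r / (1 - r))) \<le> 1"
  proof -
    have "lambda k m r \<le> 0"
      using lambda_strict_mono[OF mk r(1), of "max_root k m"] z max_root[OF mk]
      by (cases "r = max_root k m") (auto simp: r_def)
    then have lam: "2 * (1 + k) * r * (1 + p) \<le> (1 - r) * (1 - p)"
      by (simp add: lambda_def p_def algebra_simps)
    have "((1 + k) * r) * ((1 + c) * (1 + c * p)) \<le> ((1 + k) * r) * (2 * (1 + p))"
      using mk r c p by (intro mult_left_mono mult_mono) (auto simp: mult_left_le_one_le)
    also have "\<dots> \<le> (1 - r) * (1 - p)"
      using lam by (simp add: algebra_simps)
    finally have "(1 + k) * (1 + c) * (r / (1 - r)) \<le> (1 - p) / (1 + c * p)"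
      using r c p by (simp add: field_simps add_pos_nonneg)
    then have "(1 - c) * ((1 + k) * (1 + c) * (r / (1 - r))) \<le> (1 - c) * ((1 - p) / (1 + c * p))"
      using c by (intro mult_left_mono) auto
    moreover have "(1 - c) * ((1 - p) / (1 + c * p)) = 1 - (c + p) / (1 + c * p)"
    proof -
      have "1 + c * p \<noteq> 0" using c p by (simp add: add_pos_nonneg less_imp_neq[symmetric])
      then show ?thesis by (simp add: field_simps)
    qed
    moreover have "(1 - c) * ((1 + k) * (1 + c) * s) = (1 + k) * ((1 - c\<^sup>2) * s)" for s
      by (simp add: power2_eq_square algebra_simps)
    ultimately show ?thesis
      by simp
  qed
  ultimately show ?thesis
    unfolding bohr_sum_def r_def [symmetric] by (simp add: algebra_simps)
qed

section \<open>Sharpness of the maximal root\<close>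

lemma max_root_sharp:
  assumes mk: "m \<ge> 1" "0 \<le> k" and R: "max_root k m < R" "R < 1"
  obtains f h g a b where "harmonic_mapping f h g a b" "h \<in> class_B"
    "\<And>z. z \<in> unit_disc \<Longrightarrow> cmod (deriv g z) \<le> k * cmod (deriv h z)"
    "bohr_sum m h a b (of_real R) R > 1"
proof -
  define p where "p = R ^ m"
  have R0: "0 < R" using R max_root(1)[OF mk] by simp
  have p: "0 \<le> p" "p < 1"
    using R R0 mk by (auto simp: p_def power_less_one_iff)
  have lam: "lambda k m R > 0"
    using lambda_strict_mono[OF mk _ R(1)] R max_root[OF mk] by simp
  \<comment> \<open>For \<open>0 < t < 1\<close>, the sign of \<open>\<delta> t\<close> decides
    whether the Bohr sum at \<open>R\<close> exceeds 1 for the automorphism with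
    \<open>h 0 = t\<close>, after division by \<open>1 - t\<close> and clearing of denominators. As
    \<open>\<delta> 1 = lambda k m R > 0\<close>, continuity provides such a
    \<open>t\<close>.\<close>
  define \<delta> where "\<delta> t = (1 + k) * (1 + t) * R * (1 + t * p) - (1 - t * R) * (1 - p)" for t
  have "(\<delta> \<longlongrightarrow> \<delta> 1) (at_left 1)"
    unfolding \<delta>_def by (intro tendsto_intros)
  moreover have "\<delta> 1 > 0"
    using lam by (simp add: \<delta>_def lambda_def p_def algebra_simps)
  ultimately have "\<forall>\<^sub>F t in at_left 1. \<delta> t > 0"
    by (rule order_tendstoD)
  moreover have "\<forall>\<^sub>F t in at_left (1::real). t \<in> {0<..<1}"
    by (rule eventually_at_left_real) simp
  ultimately have "\<forall>\<^sub>F t in at_left 1. \<delta> t > 0 \<and> t \<in> {0<..<1}"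
    by eventually_elim simp
  then obtain t where t: "\<delta> t > 0" "0 < t" "t < 1"
    using eventually_happens'[OF trivial_limit_at_left_real] by fastforce
  \<comment> \<open>The extremal function is the disc automorphism \<open>(z + t) / (1 + t * z)\<close> with \<open>t\<close> close to 1.\<close>
  define T :: complex where "T = of_real t"
  define h where "h z = (z + T) / (1 + T * z)" for z
  \<comment> \<open>Subtracting \<open>T = h 0\<close> makes \<open>g 0 = 0\<close>, and the
    derivative condition holds with equality. The coefficients below come from the geometric
    expansion of \<open>h z - T = (1 - T\<^sup>2) * z / (1 + T * z)\<close>.\<close>
  define g where "g z = of_real k * (h z - T)" for z
  define a where "a n = (if n = 0 then T else (1 - T\<^sup>2) * (-T) ^ (n - 1))" for n
  define b where "b n = of_real k * a n" for n
  have Tz: "cmod (T * z) < 1" if "z \<in> unit_disc" for z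
    using norm_mult_less[of T 1 z 1] t that by (simp add: T_def)
  have nz: "1 + T * z \<noteq> 0" if "z \<in> unit_disc" for z
    using Tz[OF that] by (metis add_eq_0_iff norm_minus_cancel norm_one less_irrefl)
  have holh: "h holomorphic_on unit_disc"
    unfolding h_def by (intro holomorphic_intros nz)
  have holg: "g holomorphic_on unit_disc"
    unfolding g_def by (intro holomorphic_intros holh)
  have tail: "(\<lambda>n. a (Suc n) * z ^ Suc n) sums (h z - T)" if z: "z \<in> unit_disc" for z
  proof -
    have "(\<lambda>n. ((1 - T\<^sup>2) * z) * (- (T * z)) ^ n) sums (((1 - T\<^sup>2) * z) * (1 / (1 - - (T * z))))"
      using Tz[OF z] by (intro sums_mult geometric_sums) simp
    moreover have "((1 - T\<^sup>2) * z) * (- (T * z)) ^ n = a (Suc n) * z ^ Suc n" for n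
      using power_mult_distrib[of "-T" z n] by (simp add: a_def)
    moreover have "((1 - T\<^sup>2) * z) * (1 / (1 - - (T * z))) = h z - T"
      using nz[OF z] by (simp add: h_def field_simps power2_eq_square)
    ultimately show ?thesis by simp
  qed
  have "harmonic_mapping (\<lambda>z. h z + cnj (g z)) h g a b"
    unfolding harmonic_mapping_def
  proof (intro conjI ballI holh holg refl)
    fix z :: complex assume z: "z \<in> unit_disc"
    show "(\<lambda>n. a n * z ^ n) sums h z"
      using tail[OF z] sums_Suc_iff[of "\<lambda>n. a n * z ^ n" "h z - T"] by (simp add: a_def)
    show "(\<lambda>n. b (Suc n) * z ^ Suc n) sums g z"
      using sums_mult[OF tail[OF z], of "of_real k"] by (simp add: b_def g_def mult.assoc)
  qed
  moreover have "h \<in> class_B"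
    unfolding class_B_def
  proof (intro CollectI conjI ballI holh)
    fix z :: complex assume "z \<in> unit_disc"
    then show "cmod (h z) < 1"
      using Moebius_function_norm_lt_1[of "-T" z 0] t by (simp add: Moebius_function_simple h_def T_def)
  qed
  moreover have "cmod (deriv g z) \<le> k * cmod (deriv h z)" if z: "z \<in> unit_disc" for z
  proof -
    have "(h has_field_derivative deriv h z) (at z)"
      using z by (intro holomorphic_derivI[OF holh]) auto
    then have "(g has_field_derivative of_real k * deriv h z) (at z)"
      unfolding g_def by (auto intro!: derivative_eq_intros)
    then show ?thesis
      using mk by (simp add: DERIV_imp_deriv norm_mult)
  qed
  moreover have "bohr_sum m h a b (of_real R) R > 1"
  proof -
    have t2: "0 < 1 - t\<^sup>2" using t by (simp add: abs_square_less_1)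
    have na: "cmod (a (Suc n)) = (1 - t\<^sup>2) * t ^ n" for n
    proof -
      have "a (Suc n) = of_real ((1 - t\<^sup>2) * (-t) ^ n)"
        by (simp add: a_def T_def)
      then have "cmod (a (Suc n)) = \<bar>(1 - t\<^sup>2) * (-t) ^ n\<bar>"
        by (simp only: norm_of_real)
      then show ?thesis
        using t t2 by (simp add: abs_mult power_abs)
    qed
    have tR: "t * R < 1"
      using mult_strict_mono[of t 1 R 1] t R R0 by simp
    have "(\<lambda>n. ((1 - t\<^sup>2) * R) * (t * R) ^ n) sums (((1 - t\<^sup>2) * R) * (1 / (1 - t * R)))"
      using tR t R0 by (intro sums_mult geometric_sums) (simp add: abs_mult)
    then have sa: "(\<lambda>n. cmod (a (Suc n)) * R ^ Suc n) sums ((1 - t\<^sup>2) * R / (1 - t * R))"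
      by (simp add: na power_mult_distrib mult_ac)
    then have sb: "(\<lambda>n. cmod (b (Suc n)) * R ^ Suc n) sums (k * ((1 - t\<^sup>2) * R / (1 - t * R)))"
      using sums_mult[OF sa, of k] mk by (simp add: b_def norm_mult mult.assoc)
    \<comment> \<open>At a positive point the growth bound of Schwarz-Pick is attained, so
      \<open>h\<close> loses nothing here.\<close>
    have hp: "h (of_real R ^ m) = of_real ((p + t) / (1 + t * p))"
      by (simp add: h_def T_def p_def)
    have "bohr_sum m h a b (of_real R) R = (p + t) / (1 + t * p) + (1 + k) * ((1 - t\<^sup>2) * R / (1 - t * R))"
      unfolding bohr_sum_def hp sums_unique[OF sa, symmetric] sums_unique[OF sb, symmetric]
      unfolding norm_of_real using p t by (simp add: distrib_right add_nonneg_nonneg add_divide_distrib)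
    moreover have "(1 - p) / (1 + t * p) < (1 + k) * (1 + t) * (R / (1 - t * R))"
    proof -
      have "(1 - p) * (1 - t * R) < (1 + k) * (1 + t) * R * (1 + t * p)"
        using t(1) by (simp add: \<delta>_def mult.commute)
      then show ?thesis
        using tR p t by (simp add: divide_less_eq less_divide_eq add_pos_nonneg)
    qed
    then have "(1 - t) * ((1 - p) / (1 + t * p)) < (1 - t) * ((1 + k) * (1 + t) * (R / (1 - t * R)))"
      using t by (intro mult_strict_left_mono) auto
    moreover have "(1 - t) * ((1 - p) / (1 + t * p)) = 1 - (p + t) / (1 + t * p)"
    proof -
      have "1 + t * p > 0" using t p by (simp add: add_pos_nonneg)
      then show ?thesis by (simp add: field_simps)
    qed
    moreover have "(1 - t) * ((1 + k) * (1 + t) * (R / (1 - t * R))) = (1 + k) * ((1 - t\<^sup>2) * R / (1 - t * R))"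
      by (simp add: power2_eq_square algebra_simps flip: add_divide_distrib)
    ultimately show ?thesis by linarith
  qed
  ultimately show ?thesis by (rule that)
qed

theorem theorem5:
  fixes m :: nat and k :: real
  assumes "m \<ge> 1" and "0 \<le> k" and "k \<le> 1"
  shows "(\<forall>f h g a b.
            harmonic_mapping f h g a b \<longrightarrow> h \<in> class_B \<longrightarrow>
            (\<forall>z\<in>unit_disc. cmod (deriv g z) \<le> k * cmod (deriv h z)) \<longrightarrow>
            (\<forall>z\<in>unit_disc. \<forall>r. cmod z = r \<and> r \<le> max_root k m \<longrightarrow> bohr_sum m h a b z r \<le> 1)) \<and>
         (\<forall>R'. max_root k m < R' \<and> R' < 1 \<longrightarrow>
            (\<exists>f h g a b.
               harmonic_mapping f h g a b \<and> h \<in> class_B \<and>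
               (\<forall>z\<in>unit_disc. cmod (deriv g z) \<le> k * cmod (deriv h z)) \<and>
               (\<exists>z\<in>unit_disc. \<exists>r. cmod z = r \<and> r \<le> R' \<and> bohr_sum m h a b z r > 1)))"
proof (intro conjI allI impI ballI)
  fix f h g a b z r
  assume "harmonic_mapping f h g a b" "h \<in> class_B"
    "\<forall>z\<in>unit_disc. cmod (deriv g z) \<le> k * cmod (deriv h z)"
    "cmod z = r \<and> r \<le> max_root k m"
  then show "bohr_sum m h a b z r \<le> 1"
    using bohr_sum_le_one[OF assms(1,2)] by blast
next
  fix R' assume R': "max_root k m < R' \<and> R' < 1"
  then obtain f h g a b where fs: "harmonic_mapping f h g a b" "h \<in> class_B"
    "\<And>z. z \<in> unit_disc \<Longrightarrow> cmod (deriv g z) \<le> k * cmod (deriv h z)"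
    and gt: "bohr_sum m h a b (of_real R') R' > 1"
    using max_root_sharp[OF assms(1,2)] by metis
  \<comment> \<open>The inequality fails at the point \<open>R'\<close> itself, so the radius can be
    taken equal to \<open>R'\<close>.\<close>
  have "cmod (of_real R') = R'" "complex_of_real R' \<in> unit_disc"
    using R' max_root(1)[OF assms(1,2)] by auto
  with fs gt show "\<exists>f h g a b. harmonic_mapping f h g a b \<and> h \<in> class_B \<and>
      (\<forall>z\<in>unit_disc. cmod (deriv g z) \<le> k * cmod (deriv h z)) \<and>
      (\<exists>z\<in>unit_disc. \<exists>r. cmod z = r \<and> r \<le> R' \<and> bohr_sum m h a b z r > 1)"
    by (metis order_refl)
qed

end
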